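(* Let $\mathcal H$ be a finite-dimensional complex Hilbert space and $\mathcal G$ a finite set of Hermitian operators on $\mathcal H$. Then $$\mathcal A_{\mathcal G}=\mathfrak L(\mathcal G)\oplus\{Z\in\mathcal Z_{\mathcal G}:\ \mathrm{tr}(hZ)=0\ \ \forall h\in\mathcal G\}$$ (i.e. $\mathcal G$ is semi-universal) if and only if $\mathcal P_{\mathcal A}\,\widehat{\mathcal C}_{\mathcal G}\,\mathcal P_{\mathcal A}=\mathcal P_{\mathcal A}\,\widehat{\mathcal C}^{(0)}_{\mathcal G}\,\mathcal P_{\mathcal A}$.
   Context: $\mathfrak L(\mathcal G)$ is the dynamical Lie algebra: the complex linear span of $\mathcal G$ and all nested commutators of elements of $\mathcal G$. The bond algebra $\mathcal A_{\mathcal G}$ is the von Neumann algebra generated by $\mathcal G$ (containing the identity, closed under complex linear combinations, products and adjoints); the commutant is $\mathcal C_{\mathcal G}=\{Q: [Q,h]=0\ \forall h\in\mathcal G\}$; the center is $\mathcal Z_{\mathcal G}=\mathcal A_{\mathcal G}\cap\mathcal C_{\mathcal G}$. Superoperators are linear maps on $\mathrm{End}(\mathcal H)$, which carries the Hilbert–Schmidt inner product $\langle O_1,O_2\rangle=\mathrm{tr}(O_1^\dagger O_2)$. For $K\in\mathrm{End}(\mathcal H)$, $\mathcal L_K(O)=[K,O]$. The super-bond algebra $\widehat{\mathcal A}_{\mathcal G}$ is the algebra of superoperators generated (with identity, linear combinations, compositions, Hilbert–Schmidt adjoints) by $\{\mathcal L_h:h\in\mathcal G\}$, and the super-commutant $\widehat{\mathcal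 C}_{\mathcal G}$ is the set of superoperators commuting with every $\mathcal L_h$, $h\in\mathcal G$. The minimal super-commutant $\widehat{\mathcal C}^{(0)}_{\mathcal G}$ is the algebra of superoperators generated by all maps $O\mapsto Q_1OQ_2$ with $Q_1,Q_2\in\mathcal C_{\mathcal G}$ together with the projector $O\mapsto \mathrm{tr}(O)\mathbb 1$. $\mathcal P_{\mathcal A}$ denotes the superoperator that is the orthogonal (Hilbert–Schmidt) projection of $\mathrm{End}(\mathcal H)$ onto $\mathcal A_{\mathcal G}$, and for a set $\mathcal S$ of superoperators, $\mathcal P_{\mathcal A}\mathcal S\mathcal P_{\mathcal A}=\{\mathcal P_{\mathcal A}\mathcal Q\mathcal P_{\mathcal A}:\mathcal Q\in\mathcal S\}$. *)

theory Defs
  imports "HOL-Analysis.Analysis"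
begin

text \<open>Operators on the finite-dimensional Hilbert space H = C^n are matrices
  of type complex^'n^'n (the dimension is the cardinality of the finite index type 'n).
  Superoperators are complex-linear maps on this type.\<close>

type_synonym 'n op = "complex^'n^'n"
type_synonym 'n superop = "'n op \<Rightarrow> 'n op"

definition smat :: "complex \<Rightarrow> ('n::finite) op \<Rightarrow> ('n::finite) op" where
  "smat c A = (\<chi> i j. c * A$i$j)"

definition adj :: "('n::finite) op \<Rightarrow> ('n::finite) op" where
  "adj A = (\<chi> i j. cnj (A$j$i))"

definition hermitian :: "('n::finite) op \<Rightarrow> bool" where
  "hermitian A \<longleftrightarrow> adj A = A"

definition comm :: "('n::finite) op \<Rightarrow> ('n::finite) op \<Rightarrow> ('n::finite) op" where
  "comm A B = A ** B - B ** A"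

definition hs :: "('n::finite) op \<Rightarrow> ('n::finite) op \<Rightarrow> complex" where
  "hs A B = trace (adj A ** B)"

definition cspan :: "('n::finite) op set \<Rightarrow> ('n::finite) op set" where
  "cspan S = {(\<Sum>x\<in>F. smat (c x) x) | F c. finite F \<and> F \<subseteq> S}"

inductive_set nested_comms :: "('n::finite) op set \<Rightarrow> ('n::finite) op set" for G where
  gen: "h \<in> G \<Longrightarrow> h \<in> nested_comms G"
| bracket: "a \<in> nested_comms G \<Longrightarrow> b \<in> nested_comms G \<Longrightarrow> comm a b \<in> nested_comms G"

definition dla :: "('n::finite) op set \<Rightarrow> ('n::finite) op set" where
  "dla G = cspan (nested_comms G)"

text \<open>Bond algebra: the *-algebra with identity generated by G (in finite dimension
  this is the von Neumann algebra generated by G).\<close>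
inductive_set bond_alg :: "('n::finite) op set \<Rightarrow> ('n::finite) op set" for G where
  one: "mat 1 \<in> bond_alg G"
| gen: "h \<in> G \<Longrightarrow> h \<in> bond_alg G"
| add: "a \<in> bond_alg G \<Longrightarrow> b \<in> bond_alg G \<Longrightarrow> a + b \<in> bond_alg G"
| scale: "a \<in> bond_alg G \<Longrightarrow> smat c a \<in> bond_alg G"
| mult: "a \<in> bond_alg G \<Longrightarrow> b \<in> bond_alg G \<Longrightarrow> a ** b \<in> bond_alg G"
| adjoint: "a \<in> bond_alg G \<Longrightarrow> adj a \<in> bond_alg G"

definition commutant :: "('n::finite) op set \<Rightarrow> ('n::finite) op set" where
  "commutant G = {Q. \<forall>h\<in>G. Q ** h = h ** Q}"

definition center :: "('n::finite) op set \<Rightarrow> ('n::finite) op set" where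
  "center G = bond_alg G \<inter> commutant G"

definition semi_universal :: "('n::finite) op set \<Rightarrow> bool" where
  "semi_universal G \<longleftrightarrow>
     (let L = dla G; Z = {Z \<in> center G. \<forall>h\<in>G. trace (h ** Z) = 0} in
       bond_alg G = {x + y | x y. x \<in> L \<and> y \<in> Z} \<and> L \<inter> Z = {0})"

definition clinear_sop :: "('n::finite) superop \<Rightarrow> bool" where
  "clinear_sop F \<longleftrightarrow> (\<forall>A B. F (A + B) = F A + F B) \<and> (\<forall>c A. F (smat c A) = smat c (F A))"

definition Lsop :: "('n::finite) op \<Rightarrow> ('n::finite) superop" where
  "Lsop K = (\<lambda>X. comm K X)"

definition super_commutant :: "('n::finite) op set \<Rightarrow> ('n::finite) superop set" where
  "super_commutant G = {F. clinear_sop F \<and> (\<forall>h\<in>G. F \<circ> Lsop h = Lsop h \<circ> F)}"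

inductive_set min_super_commutant :: "('n::finite) op set \<Rightarrow> ('n::finite) superop set" for G where
  ident: "id \<in> min_super_commutant G"
| sandwich: "Q1 \<in> commutant G \<Longrightarrow> Q2 \<in> commutant G \<Longrightarrow>
     (\<lambda>X. Q1 ** X ** Q2) \<in> min_super_commutant G"
| trproj: "(\<lambda>X. smat (trace X) (mat 1)) \<in> min_super_commutant G"
| add: "F \<in> min_super_commutant G \<Longrightarrow> F' \<in> min_super_commutant G \<Longrightarrow>
     (\<lambda>X. F X + F' X) \<in> min_super_commutant G"
| scale: "F \<in> min_super_commutant G \<Longrightarrow> (\<lambda>X. smat c (F X)) \<in> min_super_commutant G"
| comp: "F \<in> min_super_commutant G \<Longrightarrow> F' \<in> min_super_commutant G \<Longrightarrow>
     F \<circ> F' \<in> min_super_commutant G"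

definition orth_proj :: "('n::finite) op set \<Rightarrow> ('n::finite) superop" where
  "orth_proj S = (\<lambda>X. THE P. P \<in> S \<and> (\<forall>Y\<in>S. hs Y (X - P) = 0))"

definition sandwich_set :: "('n::finite) superop \<Rightarrow> ('n::finite) superop set \<Rightarrow> ('n::finite) superop set" where
  "sandwich_set P S = {P \<circ> Q \<circ> P | Q. Q \<in> S}"

end

theory Submission
  imports Defs
begin

text \<open>Let A be the bond algebra with center Z, and L the dynamical Lie algebra. Commutators span the
  orthogonal complement of Z in A, and L is invariant under brackets with G, so its orthogonal
  projection commutes with them.

  If G is semi-universal, the compression f to A of an element of the super-commutant commutes with
  all brackets with elements of A, so [f x, y] = [x, f y]. Then f x = z x + m x for some z in Z and
  a map m into Z that kills commutators (a theorem of Bresar on commuting maps); hence m factors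
  through the projection onto Z and f lies in the compressed minimal super-commutant.

  Conversely, maps in the compressed minimal super-commutant have the form x \<mapsto> z x + m x on A with
  z in Z and m x in Z. Applied to the projection onto L, which fixes G, this gives that (1 - z) h is
  central for h in G. So 1 - z annihilates all commutators of A, the projection fixes them, and L
  contains them.\<close>

section \<open>Matrix operations\<close>

lemma matrix_mult_eq_sum: "(A ** B) $ i $ j = (\<Sum>k\<in>UNIV. A $ i $ k * B $ k $ j)"
  by (simp add: matrix_matrix_mult_def)

lemma matrix_sub_ldistrib: "A ** (B - C) = A ** B - A ** (C :: 'a::ring_1^'n^'m)"
  by (simp add: vec_eq_iff matrix_mult_eq_sum right_diff_distrib sum_subtractf)

lemma matrix_sub_rdistrib: "(A - B) ** C = A ** C - B ** (C :: 'a::ring_1^'n^'m)"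
  by (simp add: vec_eq_iff matrix_mult_eq_sum left_diff_distrib sum_subtractf)

lemma matrix_add_rdistrib: "(A + B) ** C = A ** C + B ** (C :: 'a::ring_1^'n^'m)"
  by (simp add: vec_eq_iff matrix_mult_eq_sum distrib_right sum.distrib)

lemma matrix_mult_zero [simp]:
  "(0 :: 'a::ring_1^'m^'k) ** C = 0" "C ** (0 :: 'a::ring_1^'m^'k) = 0"
  by (simp_all add: vec_eq_iff matrix_mult_eq_sum)

lemma matrix_minus_distrib:
  "(- A) ** B = - (A ** B)" "A ** (- B) = - (A ** (B :: 'a::ring_1^'n^'m))"
  by (simp_all add: vec_eq_iff matrix_mult_eq_sum sum_negf)

lemmas matrix_simps = matrix_sub_ldistrib matrix_sub_rdistrib matrix_add_ldistrib
  matrix_add_rdistrib matrix_minus_distrib matrix_mul_assoc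

lemma smat_simps:
  "smat c A ** B = smat c (A ** B)" "A ** smat c B = smat c (A ** B)"
  "trace (smat c A) = c * trace A" "adj (smat c A) = smat (cnj c) (adj A)"
  "smat c (A + B) = smat c A + smat c B" "smat c (A - B) = smat c A - smat c B"
  "smat (c + d) A = smat c A + smat d A" "smat (c - d) A = smat c A - smat d A"
  "smat c (smat d A) = smat (c * d) A"
  "smat 1 A = A" "smat 0 A = 0" "smat c 0 = 0" "smat (- 1) A = - A"
  by (simp_all add: vec_eq_iff matrix_mult_eq_sum smat_def trace_def adj_def algebra_simps
      sum_distrib_left)

lemma smat_sum: "smat c (\<Sum>x\<in>F. g x) = (\<Sum>x\<in>F. smat c (g x))"
  by (induction F rule: infinite_finite_induct) (simp_all add: smat_simps)

lemma scaleR_eq_smat: "r *\<^sub>R A = smat (complex_of_real r) A"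
  by (simp add: vec_eq_iff smat_def scaleR_conv_of_real[where 'a=complex])

lemma adj_simps [simp]:
  "adj (adj A) = A" "adj (A + B) = adj A + adj B" "adj (A - B) = adj A - adj B"
  "adj 0 = 0" "adj (mat 1) = mat 1" "adj (A ** B) = adj B ** adj A"
  by (auto simp: vec_eq_iff matrix_mult_eq_sum adj_def mat_def mult.commute)

lemma comm_simps:
  "comm (a + b) x = comm a x + comm b x" "comm a (x + y) = comm a x + comm a y"
  "comm a (x - y) = comm a x - comm a y" "comm (a - b) x = comm a x - comm b x"
  "comm a 0 = 0" "comm 0 a = 0"
  "comm (smat c a) x = smat c (comm a x)" "comm a (smat c x) = smat c (comm a x)"
  by (simp_all add: comm_def matrix_simps smat_simps)

lemma adj_comm: "adj (comm a b) = comm (adj b) (adj a)"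
  by (simp add: comm_def)

lemma comm_jacobi: "comm (comm a b) x = comm a (comm b x) - comm b (comm a x)"
  by (simp add: comm_def matrix_simps)

lemma comm_swap: "comm a b = - comm b a"
  by (simp add: comm_def)

lemma trace_comm [simp]: "trace (comm a x) = 0"
  by (simp add: comm_def trace_sub trace_mul_sym[of a x])

lemma trace_comm_mult: "trace (comm a b ** c) = trace (a ** comm b c)"
  using trace_mul_sym[of b "a ** c"]
  by (simp add: comm_def matrix_simps trace_sub)

section \<open>The Hilbert-Schmidt form\<close>

lemma hs_simps:
  "hs (A + B) C = hs A C + hs B C" "hs A (B + C) = hs A B + hs A C"
  "hs A (B - C) = hs A B - hs A C" "hs (A - B) C = hs A C - hs B C"
  "hs (smat c A) B = cnj c * hs A B" "hs A (smat c B) = c * hs A B"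
  "hs A 0 = 0" "hs 0 A = 0"
  by (simp_all add: hs_def matrix_simps smat_simps trace_add trace_sub trace_0[unfolded mat_0])

lemma hs_cnj: "cnj (hs A B) = hs B A"
  by (simp add: hs_def trace_def matrix_mult_eq_sum adj_def mult.commute)

text \<open>Links the complex form to the real inner product on the matrix type, so that real
  orthogonal decompositions and orthonormal bases become available.\<close>

lemma Re_hs: "Re (hs A B) = A \<bullet> B"
proof -
  have "Re (hs A B) = (\<Sum>i\<in>UNIV. \<Sum>k\<in>UNIV. A $ k $ i \<bullet> B $ k $ i)"
    by (simp add: hs_def trace_def matrix_mult_eq_sum adj_def inner_complex_def)
  also have "\<dots> = A \<bullet> B"
    by (subst sum.swap) (simp add: inner_vec_def)
  finally show ?thesis .
qed

lemma hs_self_eq_0 [simp]: "hs A A = 0 \<longleftrightarrow> A = 0"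
  by (metis Re_hs hs_simps(7) inner_eq_zero_iff zero_complex.sel(1))

lemma hs_mult_left: "hs Y (a ** X) = hs (adj a ** Y) X"
  by (simp add: hs_def matrix_simps)

lemma hs_mult_right: "hs Y (X ** a) = hs (Y ** adj a) X"
  using trace_mul_sym[of "adj Y ** X" a] by (simp add: hs_def matrix_simps)

lemma hs_comm: "hs v (comm a x) = hs (comm (adj a) v) x"
  by (simp add: comm_def hs_simps hs_mult_left[of v a x] hs_mult_right[of v x a])

section \<open>Complex subspaces and orthogonal projections\<close>

definition csubspace :: "('n::finite) op set \<Rightarrow> bool" where
  "csubspace S \<longleftrightarrow> 0 \<in> S \<and> (\<forall>x\<in>S. \<forall>y\<in>S. x + y \<in> S) \<and> (\<forall>c. \<forall>x\<in>S. smat c x \<in> S)"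

lemma csubspaceD:
  assumes "csubspace S"
  shows "0 \<in> S" "x \<in> S \<Longrightarrow> y \<in> S \<Longrightarrow> x + y \<in> S" "x \<in> S \<Longrightarrow> smat c x \<in> S"
    "x \<in> S \<Longrightarrow> y \<in> S \<Longrightarrow> x - y \<in> S"
proof -
  show 1: "0 \<in> S" "x \<in> S \<Longrightarrow> y \<in> S \<Longrightarrow> x + y \<in> S" "x \<in> S \<Longrightarrow> smat c x \<in> S" for x y c
    using assms by (auto simp: csubspace_def)
  show "x \<in> S \<Longrightarrow> y \<in> S \<Longrightarrow> x - y \<in> S"
    using 1(2)[of x "smat (-1) y"] 1(3)[of y "-1"] by (simp add: smat_simps)
qed

lemma csubspace_sum: "csubspace S \<Longrightarrow> (\<And>x. x \<in> F \<Longrightarrow> g x \<in> S) \<Longrightarrow> sum g F \<in> S"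
  by (induction F rule: infinite_finite_induct) (auto dest: csubspaceD)

lemma csubspace_imp_subspace: "csubspace S \<Longrightarrow> subspace S"
  by (simp add: subspace_def scaleR_eq_smat csubspaceD)

lemma hs_eq_0_on_csubspace_iff:
  assumes "csubspace S"
  shows "(\<forall>Y\<in>S. hs Y X = 0) \<longleftrightarrow> (\<forall>Y\<in>S. Y \<bullet> X = 0)"
proof
  assume *: "\<forall>Y\<in>S. Y \<bullet> X = 0"
  show "\<forall>Y\<in>S. hs Y X = 0"
  proof
    fix Y assume Y: "Y \<in> S"
    \<comment> \<open>A complex subspace contains \<open>smat \<i> Y\<close> along with
      \<open>Y\<close>, and \<open>Re (hs (smat \<i> Y) X)\<close> is the imaginary part of
      \<open>hs Y X\<close>.\<close>
    then have "Re (hs Y X) = 0" "Re (hs (smat \<i> Y) X) = 0"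
      using * assms by (simp_all add: Re_hs csubspaceD)
    then show "hs Y X = 0" by (simp add: hs_simps complex_eq_iff)
  qed
qed (auto simp flip: Re_hs)

text \<open>The difference of two candidates lies in \<open>S\<close> and is orthogonal to itself.
  This justifies the definite description in \<open>orth_proj\<close> and is the tool for computing
  projections.\<close>

lemma orth_proj_unique:
  assumes S: "csubspace S" and P: "P \<in> S" "\<And>Y. Y \<in> S \<Longrightarrow> hs Y (X - P) = 0"
  shows "orth_proj S X = P"
  unfolding orth_proj_def
proof (rule the_equality)
  fix Q assume Q: "Q \<in> S \<and> (\<forall>Y\<in>S. hs Y (X - Q) = 0)"
  then have "hs (Q - P) (X - P) - hs (Q - P) (X - Q) = 0"
    using P csubspaceD(4)[OF S, of Q P] by simp
  moreover have "hs (Q - P) (X - P) - hs (Q - P) (X - Q) = hs (Q - P) (Q - P)"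
    by (simp add: hs_simps(3) algebra_simps)
  ultimately have "hs (Q - P) (Q - P) = 0" by simp
  then show "Q = P" by simp
qed (use P in auto)

text \<open>Existence comes from the real orthogonal decomposition, since real orthogonality to a
  complex subspace is already Hilbert-Schmidt orthogonality.\<close>

lemma orth_proj_props:
  assumes S: "csubspace S"
  shows "orth_proj S X \<in> S" "Y \<in> S \<Longrightarrow> hs Y (X - orth_proj S X) = 0"
proof -
  have sp: "span S = S" using csubspace_imp_subspace[OF S] by (simp add: span_eq_iff)
  obtain y z where "y \<in> span S" "\<And>w. w \<in> span S \<Longrightarrow> orthogonal z w" "X = y + z"
    using orthogonal_subspace_decomp_exists by blast
  then have y: "y \<in> S" "\<forall>w\<in>S. w \<bullet> (X - y) = 0"
    unfolding sp by (auto simp: orthogonal_def inner_commute)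
  then have h: "\<forall>w\<in>S. hs w (X - y) = 0" by (simp add: hs_eq_0_on_csubspace_iff[OF S])
  then have "orth_proj S X = y" using orth_proj_unique[OF S] y by blast
  then show "orth_proj S X \<in> S" "Y \<in> S \<Longrightarrow> hs Y (X - orth_proj S X) = 0" using y h by auto
qed

lemma orth_proj_id [simp]: "csubspace S \<Longrightarrow> X \<in> S \<Longrightarrow> orth_proj S X = X"
  by (rule orth_proj_unique) (auto simp: hs_simps)

lemma orth_proj_add: "csubspace S \<Longrightarrow> orth_proj S (X + Y) = orth_proj S X + orth_proj S Y"
  by (rule orth_proj_unique)
    (auto intro: csubspaceD orth_proj_props simp: add_diff_add hs_simps(2) orth_proj_props)

lemma orth_proj_smat: "csubspace S \<Longrightarrow> orth_proj S (smat c X) = smat c (orth_proj S X)"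
  by (rule orth_proj_unique)
    (auto intro: csubspaceD orth_proj_props simp: orth_proj_props hs_simps(6) simp flip: smat_simps(6))

lemma orth_proj_diff: "csubspace S \<Longrightarrow> orth_proj S (X - Y) = orth_proj S X - orth_proj S Y"
  using orth_proj_add[of S X "smat (-1) Y"] by (simp add: orth_proj_smat) (simp add: smat_simps)

lemma clinear_orth_proj: "csubspace S \<Longrightarrow> clinear_sop (orth_proj S)"
  by (simp add: clinear_sop_def orth_proj_add orth_proj_smat)

text \<open>Because \<open>adj a\<close> preserves \<open>S\<close>, left multiplication by
  \<open>a\<close> preserves the orthogonal complement as well as \<open>S\<close>.\<close>

lemma orth_proj_mult_left:
  assumes S: "csubspace S" and "\<And>Y. Y \<in> S \<Longrightarrow> a ** Y \<in> S" "\<And>Y. Y \<in> S \<Longrightarrow> adj a ** Y \<in> S"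
  shows "orth_proj S (a ** X) = a ** orth_proj S X"
  by (rule orth_proj_unique[OF S])
    (auto simp: assms orth_proj_props[OF S] hs_mult_left simp flip: matrix_sub_ldistrib)

lemma orth_proj_mult_right:
  assumes S: "csubspace S" and "\<And>Y. Y \<in> S \<Longrightarrow> Y ** a \<in> S" "\<And>Y. Y \<in> S \<Longrightarrow> Y ** adj a \<in> S"
  shows "orth_proj S (X ** a) = orth_proj S X ** a"
  by (rule orth_proj_unique[OF S])
    (auto simp: assms orth_proj_props[OF S] hs_mult_right simp flip: matrix_sub_rdistrib)

text \<open>Bracketing with a Hermitian \<open>h\<close> is self-adjoint for \<open>hs\<close>, so
  it preserves the orthogonal complement along with \<open>S\<close>.\<close>

lemma orth_proj_comm:
  assumes S: "csubspace S" and "\<And>Y. Y \<in> S \<Longrightarrow> comm h Y \<in> S" and h: "hermitian h"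
  shows "orth_proj S (comm h X) = comm h (orth_proj S X)"
  by (rule orth_proj_unique[OF S])
    (use h in \<open>auto simp: assms orth_proj_props[OF S] hs_comm hermitian_def simp flip: comm_simps(3)\<close>)

lemma clinear_sopD:
  assumes "clinear_sop F"
  shows "F (A + B) = F A + F B" "F (smat c A) = smat c (F A)" "F 0 = 0" "F (A - B) = F A - F B"
proof -
  show 1: "F (A + B) = F A + F B" "F (smat c A) = smat c (F A)" for A B c
    using assms by (auto simp: clinear_sop_def)
  show "F 0 = 0" using 1(2)[of 0 0] by (simp add: smat_simps)
  show "F (A - B) = F A - F B"
    using 1(1)[of A "smat (-1) B"] unfolding 1(2) by (simp add: smat_simps)
qed

text \<open>The real inner product is the real part of \<^const>\<open>hs\<close>. Over a real orthonormal basis of a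
  complex subspace, the imaginary parts contribute a second copy of the projection, whence the
  factor 1/2.\<close>

lemma orth_proj_expansion:
  fixes S :: "('n::finite) op set"
  assumes S: "csubspace S"
  obtains B where "finite B" "B \<subseteq> S"
    "\<And>X. orth_proj S X = smat (1/2) (\<Sum>b\<in>B. smat (hs b X) b)"
proof -
  obtain B where B: "B \<subseteq> S" "pairwise orthogonal B" "\<And>x. x \<in> B \<Longrightarrow> norm x = 1"
    "independent B" "span B = S"
    using orthonormal_basis_subspace[OF csubspace_imp_subspace[OF S]] by metis
  have fin: "finite B" using B(4) independent_imp_finite by blast
  have P: "orth_proj S X = (\<Sum>b\<in>B. (b \<bullet> X) *\<^sub>R b)" for X
  proof -
    have eq: "b \<bullet> orth_proj S X = b \<bullet> X" if "b \<in> B" for b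
    proof -
      have "hs b (X - orth_proj S X) = 0" using orth_proj_props[OF S] B that by blast
      then have "b \<bullet> (X - orth_proj S X) = 0" by (metis Re_hs zero_complex.sel(1))
      then show ?thesis by (simp add: inner_diff_right)
    qed
    have "orth_proj S X = (\<Sum>b\<in>B. (b \<bullet> orth_proj S X) *\<^sub>R b)"
      using orthonormal_basis_expand[OF B(2,3), of "orth_proj S X"] B(5) fin orth_proj_props[OF S]
      by (simp add: inner_commute)
    also have "\<dots> = (\<Sum>b\<in>B. (b \<bullet> X) *\<^sub>R b)" by (simp add: eq)
    finally show ?thesis .
  qed
  \<comment> \<open>The imaginary part of \<open>hs b X\<close> is minus the real inner product of
    \<open>b\<close> with \<open>smat \<i> X\<close>. Summed over \<open>B\<close>, this term yields
    the second copy of the projection, by complex linearity.\<close>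
  have e: "smat (hs b X) b = (b \<bullet> X) *\<^sub>R b - smat \<i> ((b \<bullet> smat \<i> X) *\<^sub>R b)" for b X
  proof -
    have "hs b X = complex_of_real (b \<bullet> X) - \<i> * complex_of_real (b \<bullet> smat \<i> X)"
      by (simp add: complex_eq_iff hs_simps flip: Re_hs)
    then show ?thesis
      by (simp add: scaleR_eq_smat smat_simps)
  qed
  have "(\<Sum>b\<in>B. smat (hs b X) b) = orth_proj S X - smat \<i> (orth_proj S (smat \<i> X))" for X
    by (simp only: e sum_subtractf P smat_sum)
  also have "\<dots> X = smat 2 (orth_proj S X)" for X
    by (simp add: orth_proj_smat[OF S]) (simp add: vec_eq_iff smat_def)
  finally have "orth_proj S X = smat (1/2) (\<Sum>b\<in>B. smat (hs b X) b)" for X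
    by (simp add: smat_simps)
  then show ?thesis using that fin B(1) by blast
qed

section \<open>The centroid of a matrix *-algebra\<close>

lemma comm_mult:
  "comm (a ** b) c = a ** comm b c + comm a c ** b"
  "comm a (b ** c) = b ** comm a c + comm a b ** c"
  by (simp_all add: comm_def matrix_simps)

locale star_algebra =
  fixes A :: "('n::finite) op set"
  assumes csub: "csubspace A"
    and one: "mat 1 \<in> A"
    and mult: "a \<in> A \<Longrightarrow> b \<in> A \<Longrightarrow> a ** b \<in> A"
    and adj: "a \<in> A \<Longrightarrow> adj a \<in> A"
begin

definition Z :: "'n op set" where
  "Z = {z \<in> A. \<forall>a\<in>A. z ** a = a ** z}"

lemmas closed = csubspaceD[OF csub] one mult adj

lemma comm_closed: "a \<in> A \<Longrightarrow> b \<in> A \<Longrightarrow> comm a b \<in> A"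
  by (simp add: comm_def closed)

lemma csubspace_Z: "csubspace Z"
  by (auto simp: csubspace_def Z_def closed matrix_simps smat_simps)

lemma Z_iff: "z \<in> Z \<longleftrightarrow> z \<in> A \<and> (\<forall>a\<in>A. comm z a = 0)"
  by (simp add: Z_def comm_def)

lemma comm_Z: "z \<in> Z \<Longrightarrow> a \<in> A \<Longrightarrow> comm z a = 0" "z \<in> Z \<Longrightarrow> a \<in> A \<Longrightarrow> comm a z = 0"
  by (auto simp: Z_def comm_def)

lemma one_Z: "mat 1 \<in> Z"
  by (simp add: Z_def one)

text \<open>The bimodule property of a conditional expectation onto \<open>A\<close>.\<close>

lemma orth_proj_mult:
  assumes "a \<in> A"
  shows "orth_proj A (a ** X) = a ** orth_proj A X" "orth_proj A (X ** a) = orth_proj A X ** a"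
  using assms by (simp_all add: orth_proj_mult_left orth_proj_mult_right closed csub)

text \<open>Moving a bracket across \<open>hs\<close> turns the squared norm of
  \<open>comm x v\<close> into the pairing of \<open>v\<close> with the commutator of
  \<open>adj x\<close> and \<open>comm x v\<close>, which vanishes.\<close>

lemma in_Z_if_orthogonal_commutators:
  assumes v: "v \<in> A" and o: "\<And>x y. x \<in> A \<Longrightarrow> y \<in> A \<Longrightarrow> hs v (comm x y) = 0"
  shows "v \<in> Z"
proof -
  have "comm v x = 0" if "x \<in> A" for x
  proof -
    have "hs (comm x v) (comm x v) = hs v (comm (adj x) (comm x v))"
      by (simp add: hs_comm)
    then have "comm x v = 0" using o[of "adj x" "comm x v"] that v by (simp add: closed comm_closed)
    then show ?thesis by (simp add: comm_def)
  qed
  then show ?thesis using v by (simp add: Z_iff)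
qed

text \<open>The commutators span the orthogonal complement of \<^term>\<open>Z\<close> in \<^term>\<open>A\<close>.\<close>

lemma vanish_if_vanish_on_commutators:
  assumes f: "clinear_sop f" and fc: "\<And>x y. x \<in> A \<Longrightarrow> y \<in> A \<Longrightarrow> f (comm x y) = 0"
    and X: "X \<in> A" "\<And>z. z \<in> Z \<Longrightarrow> hs z X = 0"
  shows "f X = 0"
proof -
  let ?W = "{x \<in> A. f x = 0}"
  have W: "csubspace ?W"
    by (auto simp: csubspace_def closed clinear_sopD[OF f] smat_simps)
  \<comment> \<open>The component of \<open>X\<close> orthogonal to the kernel \<open>?W\<close> is
    orthogonal to all commutators, hence central. It is then orthogonal both to \<open>X\<close> and
    to \<open>orth_proj ?W X\<close>, so it is 0.\<close>
  define d where "d = X - orth_proj ?W X"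
  have PW: "orth_proj ?W X \<in> ?W" by (rule orth_proj_props(1)[OF W])
  have d: "d \<in> A" using PW X by (auto simp: d_def closed)
  have dW: "hs d Y = 0" if "Y \<in> ?W" for Y
    using orth_proj_props(2)[OF W that, of X] hs_cnj[of Y d] by (simp add: d_def)
  have "d \<in> Z"
    using d dW fc comm_closed by (intro in_Z_if_orthogonal_commutators) auto
  then have "hs d X = 0" using X by simp
  moreover have "hs d X = hs d d + hs d (orth_proj ?W X)"
    by (simp add: d_def flip: hs_simps(2))
  ultimately have "d = 0" using dW[OF PW] by simp
  then show ?thesis using PW by (simp add: d_def)
qed

text \<open>The map (x, y) \<mapsto> [f x, y] = [x, f y] is a derivation in each argument. Expanding its value
  at (x u, y v) in two ways gives the case z = 1.\<close>

lemma biderivation_identity: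
  assumes f: "\<And>x. x \<in> A \<Longrightarrow> f x \<in> A"
    and c: "\<And>x y. x \<in> A \<Longrightarrow> y \<in> A \<Longrightarrow> comm (f x) y = comm x (f y)"
    and A: "x \<in> A" "y \<in> A" "z \<in> A" "u \<in> A" "v \<in> A"
  shows "comm (f x) y ** z ** comm u v = comm x y ** z ** comm (f u) v"
proof -
  \<comment> \<open>Moving \<open>f\<close> to the second argument lets the derivation rule act on
    the product \<open>a ** b\<close>; then \<open>f\<close> is moved back.\<close>
  have L: "comm (f (a ** b)) w = a ** comm (f b) w + comm (f a) w ** b"
    if "a \<in> A" "b \<in> A" "w \<in> A" for a b w
    using that by (simp add: c closed comm_mult)
  have base: "comm (f x) y ** comm u v = comm x y ** comm (f u) v"
    if "x \<in> A" "y \<in> A" "u \<in> A" "v \<in> A" for x y u v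
  proof -
    \<comment> \<open>Here \<open>x ** u\<close> is split first, below \<open>y ** v\<close>. With
      D(x,y) for \<open>comm (f x) y\<close>, the terms containing D(u,y) and D(x,v) agree, and
      [x,y] D(u,v) = D(x,y) [u,v] remains.\<close>
    have "x ** (y ** comm (f u) v + comm (f u) y ** v) + (y ** comm (f x) v + comm (f x) y ** v) ** u
        = comm (f (x ** u)) (y ** v)"
      using that by (simp add: L closed flip: comm_mult)
    also have "\<dots> = y ** (x ** comm (f u) v + comm (f x) v ** u) + (x ** comm (f u) y + comm (f x) y ** u) ** v"
      using that by (simp add: L comm_mult(2)[of "f (x ** u)"])
    finally show ?thesis
      by (simp add: matrix_simps comm_def[of u v] comm_def[of x y] algebra_simps)
  qed
  \<comment> \<open>Expanded by the derivation rule, the identity at \<open>z ** u\<close> is the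
    sum of the claim and the identity at \<open>z\<close> multiplied by \<open>u\<close>.\<close>
  have "comm (f x) y ** comm (z ** u) v = comm x y ** comm (f (z ** u)) v"
    using A by (intro base closed)
  moreover have "comm (f x) y ** comm z v = comm x y ** comm (f z) v"
    using A by (intro base)
  ultimately show ?thesis
    using A by (simp add: L comm_mult matrix_simps)
qed

text \<open>It suffices to find a central \<open>z\<close> with
  \<open>comm (f x) y = comm x y ** z\<close>. The biderivation identity provides such a multiplier
  locally, on the ideal generated by commutators; the unit of a suitable ideal turns it into a
  single element \<open>g\<close>, which becomes central once its part annihilated by all
  commutators is removed.\<close>

lemma centroid:
  assumes f: "\<And>x. x \<in> A \<Longrightarrow> f x \<in> A"
    and c: "\<And>x y. x \<in> A \<Longrightarrow> y \<in> A \<Longrightarrow> comm (f x) y = comm x (f y)"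
  obtains z where "z \<in> Z" "\<And>x. x \<in> A \<Longrightarrow> f x - z ** x \<in> Z"
proof -
  note bid = biderivation_identity[of f, OF f c]
  \<comment> \<open>The free middle factor \<open>z\<close> absorbs left factors of
    \<open>i\<close>, which makes the set \<open>I\<close> below a two-sided ideal.\<close>
  define R where "R i g \<longleftrightarrow> (\<forall>x\<in>A. \<forall>y\<in>A. \<forall>z\<in>A. comm (f x) y ** z ** i = comm x y ** z ** g)"
    for i g :: "'n op"
  define I where "I = {i \<in> A. \<exists>g\<in>A. R i g}"
  have IA: "I \<subseteq> A" by (auto simp: I_def)
  have II: "i \<in> I" if "i \<in> A" "g \<in> A"
    "\<And>x y z. x \<in> A \<Longrightarrow> y \<in> A \<Longrightarrow> z \<in> A \<Longrightarrow> comm (f x) y ** z ** i = comm x y ** z ** g" for i g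
    using that by (auto simp: I_def R_def)
  have IE: "\<exists>g\<in>A. R i g" if "i \<in> I" for i
    using that by (auto simp: I_def)
  have RD: "comm (f x) y ** z ** i = comm x y ** z ** g"
    if "R i g" "x \<in> A" "y \<in> A" "z \<in> A" for i g x y z
    using that by (auto simp: R_def)
  have I_sub: "csubspace I"
    unfolding csubspace_def
  proof (intro conjI ballI allI)
    show "0 \<in> I" by (rule II[of 0 0]) (auto simp: closed)
  next
    fix i j assume i: "i \<in> I" and j: "j \<in> I"
    then obtain g h where g: "g \<in> A" "R i g"
      and h: "h \<in> A" "R j h"
      using IE by blast
    have "i \<in> A" "j \<in> A" using i j IA by auto
    then show "i + j \<in> I"
      by (intro II[of _ "g + h"]) (simp_all add: closed matrix_add_ldistrib g h RD[OF g(2)] RD[OF h(2)])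
  next
    fix r i assume i: "i \<in> I"
    then obtain g where g: "g \<in> A" "R i g"
      using IE by blast
    have "i \<in> A" using i IA by auto
    then show "smat r i \<in> I"
      by (intro II[of _ "smat r g"]) (simp_all add: closed smat_simps g RD[OF g(2)])
  qed
  have I_ideal: "a ** i \<in> I" "i ** a \<in> I" if a: "a \<in> A" and i: "i \<in> I" for a i
  proof -
    obtain g where g: "g \<in> A" "R i g"
      using IE i by blast
    have iA: "i \<in> A" using i IA by auto
    show "a ** i \<in> I"
    proof (rule II[of _ "a ** g"])
      fix x y z assume "x \<in> A" "y \<in> A" "z \<in> A"
      then show "comm (f x) y ** z ** (a ** i) = comm x y ** z ** (a ** g)"
        using RD[OF g(2), of x y "z ** a"] a by (simp add: closed matrix_mul_assoc)
    qed (simp_all add: a iA g closed)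
    show "i ** a \<in> I"
      by (intro II[of _ "g ** a"]) (simp_all add: a iA g closed matrix_mul_assoc RD[OF g(2)])
  qed
  have I_comm: "comm u v \<in> I" if "u \<in> A" "v \<in> A" for u v
    using that by (intro II[of _ "comm (f u) v"]) (simp_all add: bid comm_closed f)
  \<comment> \<open>Projection onto a two-sided ideal is a bimodule map, so the projection of 1 is
    central and acts as the unit of \<open>I\<close>.\<close>
  define p where "p = orth_proj I (mat 1)"
  have p: "p \<in> I" unfolding p_def by (rule orth_proj_props(1)[OF I_sub])
  have PI: "orth_proj I (a ** X) = a ** orth_proj I X" "orth_proj I (X ** a) = orth_proj I X ** a"
    if "a \<in> A" for a X
    using that by (simp_all add: orth_proj_mult_left orth_proj_mult_right closed I_sub I_ideal)
  have p_central: "a ** p = p ** a" if "a \<in> A" for a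
    using PI[OF that, of "mat 1"] by (simp add: p_def)
  have p_id: "i ** p = i" if "i \<in> I" for i
    using PI(1)[of i "mat 1"] that IA orth_proj_id[OF I_sub that] by (auto simp: p_def)
  obtain g where g: "g \<in> A" "R p g"
    using IE[OF p] by blast
  note Rg = RD[OF g(2)]
  \<comment> \<open>\<open>comm (f x) y\<close> is itself a commutator in \<open>A\<close>, hence
    lies in \<open>I\<close> and is fixed by \<open>p\<close>; so the partner \<open>g\<close> of
    \<open>p\<close> is a global multiplier.\<close>
  have Bg: "comm (f x) y = comm x y ** g" if "x \<in> A" "y \<in> A" for x y
    using Rg[of x y "mat 1"] that p_id[of "comm (f x) y"] by (simp add: closed I_comm f)
  \<comment> \<open>The relation \<open>R p g\<close> determines \<open>g\<close> only up to
    \<open>K\<close>. Centrality of \<open>p\<close> makes \<open>g\<close> central modulo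
    \<open>K\<close>.\<close>
  define K where "K = {k \<in> A. \<forall>x\<in>A. \<forall>y\<in>A. \<forall>w\<in>A. comm x y ** w ** k = 0}"
  have K_sub: "csubspace K"
    by (auto simp: csubspace_def K_def closed matrix_add_ldistrib smat_simps)
  have K_ideal: "a ** k \<in> K" "k ** a \<in> K" if "a \<in> A" "k \<in> K" for a k
  proof -
    have "comm x y ** w ** (a ** k) = 0" if "x \<in> A" "y \<in> A" "w \<in> A" for x y w
    proof -
      have "comm x y ** (w ** a) ** k = 0"
        using that \<open>a \<in> A\<close> \<open>k \<in> K\<close> closed(6) unfolding K_def by blast
      then show ?thesis by (simp add: matrix_mul_assoc)
    qed
    then show "a ** k \<in> K" using that closed(6) by (auto simp: K_def)
    show "k ** a \<in> K" using that by (auto simp: K_def matrix_mul_assoc closed)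
  qed
  have PK: "orth_proj K (a ** X) = a ** orth_proj K X" "orth_proj K (X ** a) = orth_proj K X ** a"
    if "a \<in> A" for a X
    using that by (simp_all add: orth_proj_mult_left orth_proj_mult_right closed K_sub K_ideal)
  have gK: "comm z g \<in> K" if z: "z \<in> A" for z
  proof -
    have "comm x y ** w ** comm z g = 0" if "x \<in> A" "y \<in> A" "w \<in> A" for x y w
    proof -
      have "comm x y ** w ** (z ** g) = comm (f x) y ** (w ** z ** p)"
        using Rg[of x y "w ** z"] that z by (simp add: closed matrix_mul_assoc)
      also have "\<dots> = comm (f x) y ** w ** p ** z"
        by (simp add: p_central[OF z] flip: matrix_mul_assoc)
      also have "\<dots> = comm x y ** w ** (g ** z)"
        using Rg[of x y w] that by (simp add: matrix_mul_assoc)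
      finally show ?thesis by (simp add: comm_def matrix_sub_ldistrib)
    qed
    then show ?thesis using z g by (simp add: K_def comm_closed)
  qed
  \<comment> \<open>Projection onto the ideal \<open>K\<close> commutes with brackets by
    \<open>A\<close> and fixes \<open>comm a g\<close>, so subtracting the
    \<open>K\<close>-component of \<open>g\<close> cancels all its commutators.\<close>
  define z where "z = g - orth_proj K g"
  have PKg: "orth_proj K g \<in> K" by (rule orth_proj_props(1)[OF K_sub])
  have zA: "z \<in> A" using PKg g by (auto simp: z_def K_def closed)
  have "comm z a = 0" if a: "a \<in> A" for a
  proof -
    have "comm a (orth_proj K g) = orth_proj K (comm a g)"
      by (simp add: comm_def orth_proj_diff[OF K_sub] PK[OF a])
    also have "\<dots> = comm a g" using gK[OF a] K_sub by simp
    finally have "comm a z = 0" by (simp add: z_def comm_simps)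
    then show ?thesis by (simp add: comm_def)
  qed
  then have z: "z \<in> Z" using zA by (simp add: Z_iff)
  have "f x - z ** x \<in> Z" if x: "x \<in> A" for x
  proof -
    have "comm (f x - z ** x) y = 0" if y: "y \<in> A" for y
    proof -
      have "comm x y ** mat 1 ** orth_proj K g = 0"
        using PKg x y one unfolding K_def by blast
      then have "comm x y ** z = comm (f x) y"
        by (simp add: z_def matrix_sub_ldistrib Bg x y)
      moreover have "comm x y ** z = z ** comm x y"
        using z comm_closed[OF x y] by (simp add: Z_def)
      ultimately show ?thesis
        using z y by (simp add: comm_simps comm_mult comm_Z)
    qed
    then show ?thesis using x zA f by (simp add: Z_iff closed)
  qed
  then show ?thesis using that z by blast
qed

end

section \<open>The dynamical Lie algebra and the bond algebra\<close>

lemma csubspace_cspan: "csubspace (cspan S)"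
  unfolding csubspace_def
proof (intro conjI ballI allI)
  show "0 \<in> cspan S"
    unfolding cspan_def by (intro CollectI exI[of _ "{}"]) auto
next
  fix x y assume "x \<in> cspan S" "y \<in> cspan S"
  then obtain F c E d where F: "finite F" "F \<subseteq> S" "x = (\<Sum>x\<in>F. smat (c x) x)"
    and E: "finite E" "E \<subseteq> S" "y = (\<Sum>x\<in>E. smat (d x) x)"
    unfolding cspan_def by blast
  have "x = (\<Sum>v\<in>F \<union> E. smat (if v \<in> F then c v else 0) v)"
    unfolding F(3) by (rule sum.mono_neutral_cong_left) (use F E in \<open>auto simp: smat_simps\<close>)
  moreover have "y = (\<Sum>v\<in>F \<union> E. smat (if v \<in> E then d v else 0) v)"
    unfolding E(3) by (rule sum.mono_neutral_cong_left) (use F E in \<open>auto simp: smat_simps\<close>)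
  ultimately have "x + y = (\<Sum>v\<in>F \<union> E. smat ((if v \<in> F then c v else 0) + (if v \<in> E then d v else 0)) v)"
    by (simp only: smat_simps sum.distrib)
  then show "x + y \<in> cspan S"
    unfolding cspan_def mem_Collect_eq
    by (intro exI[of _ "F \<union> E"] exI[of _ "\<lambda>v. (if v \<in> F then c v else 0) + (if v \<in> E then d v else 0)"])
      (use F E in auto)
next
  fix r x assume "x \<in> cspan S"
  then obtain F c where F: "finite F" "F \<subseteq> S" "x = (\<Sum>x\<in>F. smat (c x) x)"
    unfolding cspan_def by blast
  then have "smat r x = (\<Sum>x\<in>F. smat (r * c x) x)"
    by (simp add: smat_sum smat_simps)
  then show "smat r x \<in> cspan S"
    unfolding cspan_def mem_Collect_eq
    by (intro exI[of _ F] exI[of _ "\<lambda>v. r * c v"]) (use F in auto)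
qed

lemma cspan_superset: "x \<in> S \<Longrightarrow> x \<in> cspan S"
  unfolding cspan_def
  by (intro CollectI exI[of _ "{x}"] exI[of _ "\<lambda>_. 1"]) (auto simp: smat_simps)

lemma cspan_induct:
  assumes "x \<in> cspan S" "csubspace {x. P x}" "\<And>x. x \<in> S \<Longrightarrow> P x"
  shows "P x"
proof -
  obtain F c where F: "F \<subseteq> S" "x = (\<Sum>x\<in>F. smat (c x) x)"
    using assms(1) unfolding cspan_def by blast
  have "(\<Sum>x\<in>F. smat (c x) x) \<in> {x. P x}"
    by (rule csubspace_sum[OF assms(2)], rule csubspaceD(3)[OF assms(2)]) (use F assms(3) in auto)
  then show ?thesis using F by simp
qed

lemma csubspace_dla: "csubspace (dla G)"
  by (simp add: dla_def csubspace_cspan)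

lemma nested_comms_subset_dla: "x \<in> nested_comms G \<Longrightarrow> x \<in> dla G"
  by (simp add: dla_def cspan_superset)

lemma dla_induct:
  assumes "x \<in> dla G" "csubspace {x. P x}" "\<And>x. x \<in> nested_comms G \<Longrightarrow> P x"
  shows "P x"
  using assms cspan_induct unfolding dla_def by blast

lemma comm_dla:
  assumes h: "h \<in> G" and x: "x \<in> dla G"
  shows "comm h x \<in> dla G"
  using x
proof (rule dla_induct)
  show "csubspace {x. comm h x \<in> dla G}"
    by (auto simp: csubspace_def comm_simps csubspaceD[OF csubspace_dla])
qed (auto intro: nested_comms_subset_dla nested_comms.intros h)

locale hermitian_generators =
  fixes G :: "('n::finite) op set"
  assumes herm: "h \<in> G \<Longrightarrow> hermitian h"
begin

sublocale star_algebra "bond_alg G"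
proof
  show "csubspace (bond_alg G)"
    unfolding csubspace_def using bond_alg.scale[OF bond_alg.one, of 0]
    by (auto intro: bond_alg.intros simp: smat_simps)
qed (auto intro: bond_alg.intros)

lemma adj_nested_comms: "x \<in> nested_comms G \<Longrightarrow> adj x \<in> nested_comms G"
  by (induction rule: nested_comms.induct)
    (use herm in \<open>auto simp: adj_comm hermitian_def intro: nested_comms.intros\<close>)

lemma adj_dla: "x \<in> dla G \<Longrightarrow> adj x \<in> dla G"
proof (erule dla_induct)
  show "csubspace {x. adj x \<in> dla G}"
    by (auto simp: csubspace_def smat_simps csubspaceD[OF csubspace_dla])
qed (simp add: nested_comms_subset_dla adj_nested_comms)

lemma nested_comms_subset: "x \<in> nested_comms G \<Longrightarrow> x \<in> bond_alg G"
  by (induction rule: nested_comms.induct) (auto intro: bond_alg.gen comm_closed)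

lemma dla_subset: "x \<in> dla G \<Longrightarrow> x \<in> bond_alg G"
  by (erule dla_induct) (use csub nested_comms_subset in auto)

section \<open>The commutant, the center and a criterion for semi-universality\<close>

abbreviation C :: "'n op set" where
  "C \<equiv> commutant G"

lemma csubspace_commutant: "csubspace C"
  by (auto simp: csubspace_def commutant_def matrix_simps smat_simps)

lemma one_commutant: "mat 1 \<in> C"
  by (simp add: commutant_def)

lemma mult_commutant:
  assumes "p \<in> C" "q \<in> C"
  shows "p ** q \<in> C"
proof -
  have "p ** q ** h = h ** (p ** q)" if "h \<in> G" for h
  proof -
    have "q ** h = h ** q" "p ** h = h ** p" using assms that by (auto simp: commutant_def)
    then show ?thesis by (metis matrix_mul_assoc)
  qed
  then show ?thesis by (simp add: commutant_def)
qed

lemma adj_commutant: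
  assumes "q \<in> C"
  shows "adj q \<in> C"
proof -
  have "adj q ** h = h ** adj q" if "h \<in> G" for h
  proof -
    have "adj (h ** q) = adj (q ** h)" using assms that by (simp add: commutant_def)
    then show ?thesis using herm[OF that] by (simp add: hermitian_def)
  qed
  then show ?thesis by (simp add: commutant_def)
qed

lemma commutant_commutes:
  assumes "a \<in> bond_alg G" "q \<in> C"
  shows "q ** a = a ** q"
  using assms
proof (induction arbitrary: q rule: bond_alg.induct)
  case (gen h)
  then show ?case by (simp add: commutant_def)
next
  case (mult a b)
  then show ?case by (metis matrix_mul_assoc)
next
  \<comment> \<open>The induction hypothesis is applied to \<open>adj q\<close>, which lies in
    \<open>C\<close> because the generators are Hermitian; this is why \<open>q\<close> is kept
    arbitrary.\<close>
  case (adjoint a)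
  have "adj (adj q ** a) = adj (a ** adj q)"
    using adjoint adj_commutant by simp
  then show ?case by simp
qed (simp_all add: matrix_simps smat_simps)

lemma Z_eq_center: "Z = center G"
proof
  show "Z \<subseteq> center G" by (simp add: subset_iff Z_def center_def commutant_def bond_alg.gen)
  show "center G \<subseteq> Z" unfolding Z_def center_def using commutant_commutes by blast
qed

lemma Z_subset_commutant: "z \<in> Z \<Longrightarrow> z \<in> C"
  by (simp add: Z_eq_center center_def)

text \<open>The bimodule property carries the relation \<open>q ** a = a ** q\<close> over to the
  projection.\<close>

lemma orth_proj_commutant:
  assumes "q \<in> C"
  shows "orth_proj (bond_alg G) q \<in> Z"
proof -
  let ?P = "orth_proj (bond_alg G)"
  have "?P q ** a = a ** ?P q" if "a \<in> bond_alg G" for a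
    using orth_proj_mult[OF that, of q] commutant_commutes[OF that assms] by simp
  then show ?thesis using orth_proj_props(1)[OF csub] by (simp add: Z_def)
qed

text \<open>By invariance of the trace form, proper brackets are trace-orthogonal to the center, so
  only the generators impose a condition. This gives directness of the sum in
  semi-universality.\<close>

lemma trace_dla_mult:
  assumes z: "z \<in> Z" "\<And>h. h \<in> G \<Longrightarrow> trace (h ** z) = 0" and x: "x \<in> dla G"
  shows "trace (x ** z) = 0"
  using x
proof (rule dla_induct)
  show "csubspace {x. trace (x ** z) = 0}"
    by (auto simp: csubspace_def matrix_simps smat_simps trace_add trace_0[unfolded mat_0])
  show "trace (x ** z) = 0" if "x \<in> nested_comms G" for x
    using that
  proof cases
    case gen
    then show ?thesis by (rule z(2))
  next
    case (bracket a b)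
    then show ?thesis
      using nested_comms_subset z by (simp add: trace_comm_mult comm_Z trace_0[unfolded mat_0])
  qed
qed

lemma semi_universalD:
  assumes "semi_universal G" "X \<in> bond_alg G"
  obtains x z where "x \<in> dla G" "z \<in> Z" "X = x + z"
  using assms unfolding semi_universal_def Let_def Z_eq_center by blast

text \<open>For Hermitian generators the trace conditions are part of orthogonality to the dynamical
  Lie algebra, so the orthogonal decomposition is the required one as soon as its second component
  is central.\<close>

lemma semi_universalI:
  assumes *: "\<And>X. X \<in> bond_alg G \<Longrightarrow> X - orth_proj (dla G) X \<in> Z"
  shows "semi_universal G"
proof -
  let ?N = "{z \<in> Z. \<forall>h\<in>G. trace (h ** z) = 0}"
  let ?P = "orth_proj (dla G)"
  have "X \<in> {x + y | x y. x \<in> dla G \<and> y \<in> ?N}" if X: "X \<in> bond_alg G" for X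
  proof -
    have "trace (h ** (X - ?P X)) = 0" if "h \<in> G" for h
      using orth_proj_props(2)[OF csubspace_dla, of h G X] herm[OF that] that
      by (simp add: hs_def hermitian_def nested_comms_subset_dla nested_comms.gen)
    then have "X - ?P X \<in> ?N" using *[OF X] by simp
    moreover have "?P X \<in> dla G" by (rule orth_proj_props(1)[OF csubspace_dla])
    moreover have "X = ?P X + (X - ?P X)" by simp
    ultimately show ?thesis by blast
  qed
  moreover have "x + y \<in> bond_alg G" if "x \<in> dla G" "y \<in> ?N" for x y
    using that dla_subset by (auto simp: Z_def intro: closed)
  moreover have "x = 0" if x: "x \<in> dla G" "x \<in> ?N" for x
  proof -
    have "trace (adj x ** x) = 0" using x adj_dla by (simp add: trace_dla_mult)
    then show ?thesis using hs_self_eq_0 unfolding hs_def by blast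
  qed
  moreover have "0 \<in> ?N" "0 \<in> dla G"
    using csubspaceD(1)[OF csubspace_Z] csubspaceD(1)[OF csubspace_dla]
    by (auto simp: trace_0[unfolded mat_0])
  ultimately show ?thesis
    unfolding semi_universal_def Let_def Z_eq_center[symmetric] by blast
qed

section \<open>The super-commutants\<close>

lemma (in -) sandwich_set_image: "sandwich_set P S = (\<lambda>Q. P \<circ> Q \<circ> P) ` S"
  by (auto simp: sandwich_set_def)

lemma min_super_commutant_clinear: "F \<in> min_super_commutant G \<Longrightarrow> clinear_sop F"
  by (induction rule: min_super_commutant.induct)
    (simp_all add: clinear_sop_def matrix_simps smat_simps trace_add mult.commute)

text \<open>Elements of \<open>C\<close> commute with the whole bond algebra and the trace kills
  every commutator, so \<open>a\<close> need not be a generator. This extra strength is what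
  separates the minimal super-commutant from a general element of the super-commutant.\<close>

lemma min_super_commutant_comm:
  assumes a: "a \<in> bond_alg G"
  shows "F \<in> min_super_commutant G \<Longrightarrow> F (comm a X) = comm a (F X)"
proof (induction arbitrary: X rule: min_super_commutant.induct)
  case (sandwich p q)
  have "p ** a = a ** p" "q ** a = a ** q" using commutant_commutes a sandwich by auto
  then have "p ** (a ** X) ** q = a ** (p ** X ** q)" "p ** (X ** a) ** q = p ** X ** q ** a"
    by (metis matrix_mul_assoc)+
  then show ?case by (simp add: comm_def matrix_sub_ldistrib matrix_sub_rdistrib)
next
  case trproj
  have "comm a (mat 1) = 0" by (simp add: comm_def)
  then show ?case by (simp add: smat_simps comm_simps)
qed (simp_all add: comm_simps)

lemma min_super_commutant_subset: "min_super_commutant G \<subseteq> super_commutant G"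
proof
  fix F assume F: "F \<in> min_super_commutant G"
  then have "F (comm h X) = comm h (F X)" if "h \<in> G" for h X
    using bond_alg.gen[OF that] by (intro min_super_commutant_comm)
  then show "F \<in> super_commutant G"
    using min_super_commutant_clinear[OF F] by (simp add: super_commutant_def Lsop_def fun_eq_iff)
qed

lemma min_super_commutant_commutant: "F \<in> min_super_commutant G \<Longrightarrow> q \<in> C \<Longrightarrow> F q \<in> C"
  by (induction arbitrary: q rule: min_super_commutant.induct)
    (simp_all add: mult_commutant csubspaceD[OF csubspace_commutant] one_commutant)

text \<open>The extra factor \<^term>\<open>q\<close> is what makes the statement stable under composition.\<close>

lemma min_super_commutant_normal_form:
  "F \<in> min_super_commutant G \<Longrightarrow> q \<in> C \<Longrightarrow>
    \<exists>q'\<in>C. \<forall>Y\<in>bond_alg G. F (Y ** q) - Y ** q' \<in> C"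
proof (induction arbitrary: q rule: min_super_commutant.induct)
  case ident
  then show ?case
    using csubspaceD(1)[OF csubspace_commutant] by (intro bexI[of _ q]) auto
next
  case (sandwich p r)
  have "p ** (Y ** q) ** r - Y ** (p ** q ** r) = 0" if "Y \<in> bond_alg G" for Y
    using commutant_commutes[OF that sandwich(1)] by (simp add: matrix_mul_assoc)
  then show ?case
    using sandwich mult_commutant csubspaceD(1)[OF csubspace_commutant]
    by (intro bexI[of _ "p ** q ** r"]) auto
next
  case trproj
  then show ?case
    using csubspaceD[OF csubspace_commutant] one_commutant by (intro bexI[of _ 0]) auto
next
  case (add F F')
  obtain p where p: "p \<in> C" "\<And>Y. Y \<in> bond_alg G \<Longrightarrow> F (Y ** q) - Y ** p \<in> C"
    using add by meson
  obtain r where r: "r \<in> C" "\<And>Y. Y \<in> bond_alg G \<Longrightarrow> F' (Y ** q) - Y ** r \<in> C"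
    using add by meson
  have "F (Y ** q) + F' (Y ** q) - Y ** (p + r) \<in> C" if "Y \<in> bond_alg G" for Y
    using csubspaceD(2)[OF csubspace_commutant p(2)[OF that] r(2)[OF that]]
    by (simp add: matrix_add_ldistrib algebra_simps)
  then show ?case
    using csubspaceD(2)[OF csubspace_commutant p(1) r(1)] by blast
next
  case (scale F s)
  obtain p where p: "p \<in> C" "\<And>Y. Y \<in> bond_alg G \<Longrightarrow> F (Y ** q) - Y ** p \<in> C"
    using scale by meson
  have "smat s (F (Y ** q)) - Y ** smat s p \<in> C" if "Y \<in> bond_alg G" for Y
    using csubspaceD(3)[OF csubspace_commutant p(2)[OF that]] by (simp add: smat_simps)
  then show ?case
    using csubspaceD(3)[OF csubspace_commutant p(1)] by blast
next
  case (comp F F')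
  obtain p where p: "p \<in> C" "\<And>Y. Y \<in> bond_alg G \<Longrightarrow> F' (Y ** q) - Y ** p \<in> C"
    using comp by meson
  obtain r where r: "r \<in> C" "\<And>Y. Y \<in> bond_alg G \<Longrightarrow> F (Y ** p) - Y ** r \<in> C"
    using comp p(1) by meson
  note F = clinear_sopD[OF min_super_commutant_clinear[OF comp(1)]]
  \<comment> \<open>\<open>F' (Y ** q)\<close> is \<open>Y ** p\<close> plus an element of
    \<open>C\<close>. \<open>F\<close> maps the latter into \<open>C\<close>, and the former to
    \<open>Y ** r\<close> up to \<open>C\<close>.\<close>
  have "(F \<circ> F') (Y ** q) - Y ** r \<in> C" if "Y \<in> bond_alg G" for Y
    using csubspaceD(2)[OF csubspace_commutant r(2)[OF that]
        min_super_commutant_commutant[OF comp(1) p(2)[OF that]]]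
    by (simp add: F)
  then show ?case using r(1) by blast
qed

lemma min_super_commutant_sum:
  "(\<And>b. b \<in> B \<Longrightarrow> F b \<in> min_super_commutant G) \<Longrightarrow>
    (\<lambda>X. \<Sum>b\<in>B. F b X) \<in> min_super_commutant G"
proof (induction B rule: infinite_finite_induct)
  case (insert b B)
  then show ?case using min_super_commutant.add[of "F b" G "\<lambda>X. \<Sum>b\<in>B. F b X"] by simp
qed (use min_super_commutant.scale[OF min_super_commutant.ident, of 0] in \<open>simp_all add: smat_simps\<close>)

text \<open>The trace projector, preceded by multiplication with \<open>adj p\<close> and followed
  by multiplication with \<open>q\<close>, is this rank-one map.\<close>

lemma rank_one_min_super_commutant:
  assumes "p \<in> C" "q \<in> C"
  shows "(\<lambda>X. smat (hs p X) q) \<in> min_super_commutant G"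
proof -
  have "(\<lambda>X. q ** X ** mat 1) \<circ> ((\<lambda>X. smat (trace X) (mat 1)) \<circ> (\<lambda>X. adj p ** X ** mat 1))
      \<in> min_super_commutant G"
    using assms one_commutant adj_commutant
    by (intro min_super_commutant.comp min_super_commutant.sandwich min_super_commutant.trproj) auto
  then show ?thesis by (simp add: comp_def hs_def smat_simps)
qed

lemma orth_proj_dla_super_commutant: "orth_proj (dla G) \<in> super_commutant G"
  by (auto simp: super_commutant_def Lsop_def fun_eq_iff clinear_orth_proj csubspace_dla
      orth_proj_comm comm_dla herm)

section \<open>Compression to the bond algebra and the two implications\<close>

abbreviation P :: "'n superop" where
  "P \<equiv> orth_proj (bond_alg G)"

lemma P_comm: "a \<in> bond_alg G \<Longrightarrow> P (comm a X) = comm a (P X)"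
  by (simp add: comm_def orth_proj_diff csub orth_proj_mult)

lemma P_closed: "P X \<in> bond_alg G"
  by (rule orth_proj_props(1)[OF csub])

lemma semi_universal_if_sandwich_set_eq:
  assumes eq: "sandwich_set P (super_commutant G) = sandwich_set P (min_super_commutant G)"
  shows "semi_universal G"
proof -
  let ?D = "orth_proj (dla G)"
  note D_dla = orth_proj_props(1)[OF csubspace_dla]
  have "P \<circ> ?D \<circ> P \<in> sandwich_set P (min_super_commutant G)"
    unfolding eq[symmetric] unfolding sandwich_set_image by (rule imageI[OF orth_proj_dla_super_commutant])
  then obtain F where F: "F \<in> min_super_commutant G" "P \<circ> ?D \<circ> P = P \<circ> F \<circ> P"
    unfolding sandwich_set_image by (rule imageE)
  have D: "?D X = P (F X)" if "X \<in> bond_alg G" for X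
    using fun_cong[OF F(2), of X] that D_dla[of G X] dla_subset csub by simp
  obtain q where q: "q \<in> C" "\<And>Y. Y \<in> bond_alg G \<Longrightarrow> F (Y ** mat 1) - Y ** q \<in> C"
    using min_super_commutant_normal_form[OF F(1) one_commutant] by meson
  \<comment> \<open>Projecting the normal form shows that \<open>?D\<close> acts on the bond algebra
    as multiplication by \<open>P q\<close> up to a central term; \<open>w\<close> is the deviation
    of this multiplier from 1.\<close>
  define w where "w = mat 1 - P q"
  have w: "w \<in> Z"
    unfolding w_def by (intro csubspaceD(4)[OF csubspace_Z] one_Z orth_proj_commutant q(1))
  have wA: "w \<in> bond_alg G" using w by (simp add: Z_def)
  have Dw: "?D X - (X - X ** w) \<in> Z" if X: "X \<in> bond_alg G" for X
    using orth_proj_commutant[OF q(2)[OF X]] X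
    by (simp add: w_def orth_proj_diff csub D orth_proj_mult matrix_sub_ldistrib)
  have w_comm: "w ** c = c ** w" if "c \<in> bond_alg G" for c
    using w that by (simp add: Z_def)
  have comm_w: "comm a (b ** w) = comm a b ** w" if "a \<in> bond_alg G" for a b
    using that w by (simp add: comm_mult comm_Z)
  \<comment> \<open>The claim for \<open>adj b\<close> is carried along so that the adjoint rule
    only swaps the two conjuncts.\<close>
  have "(\<forall>a\<in>bond_alg G. comm a b ** w = 0) \<and> (\<forall>a\<in>bond_alg G. comm a (adj b) ** w = 0)"
    if "b \<in> bond_alg G" for b
    using that
  proof (induction rule: bond_alg.induct)
    case (gen h)
    have h: "h \<in> bond_alg G" by (rule bond_alg.gen[OF gen])
    \<comment> \<open>A generator is fixed by the projection, so \<open>Dw\<close> leaves exactly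
      \<open>h ** w\<close> in the center.\<close>
    have "?D h = h"
      using gen csubspace_dla nested_comms_subset_dla nested_comms.gen by (metis orth_proj_id)
    then have "h ** w \<in> Z" using Dw[OF h] by simp
    then have "comm a h ** w = 0" if "a \<in> bond_alg G" for a
      using comm_w[OF that, of h] comm_Z that by simp
    then show ?case using herm[OF gen] by (simp add: hermitian_def)
  next
    case (mult b c)
    have *: "comm a (b ** c) ** w = 0"
      if "a \<in> bond_alg G" "c \<in> bond_alg G" "comm a b ** w = 0" "comm a c ** w = 0" for a b c
    proof -
      have "comm a (b ** c) ** w = b ** (comm a c ** w) + comm a b ** (c ** w)"
        by (simp add: comm_mult matrix_simps)
      also have "comm a b ** (c ** w) = comm a b ** w ** c"
        using w_comm[OF that(2)] by (simp flip: matrix_mul_assoc)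
      finally show ?thesis using that by simp
    qed
    show ?case using mult * adj by simp
  qed (simp_all add: comm_simps smat_simps matrix_simps, simp add: comm_def)
  then have kill: "comm a b ** w = 0" if "a \<in> bond_alg G" "b \<in> bond_alg G" for a b
    using that by blast
  have commutator_dla: "comm a b \<in> dla G" if ab: "a \<in> bond_alg G" "b \<in> bond_alg G" for a b
  proof -
    \<comment> \<open>On the bond algebra \<open>?D\<close> agrees with \<open>P \<circ> F\<close>,
      hence it commutes with brackets by every \<open>a\<close> there and not only by
      generators.\<close>
    have "?D (comm a b) = comm a (?D b)"
      using ab by (simp add: D comm_closed min_super_commutant_comm[OF _ F(1)] P_comm)
    moreover have "comm a (?D b - (b - b ** w)) = 0"
      using Dw ab comm_Z by blast
    ultimately have "?D (comm a b) = comm a b"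
      using ab by (simp add: comm_simps comm_w kill)
    then show ?thesis using D_dla by metis
  qed
  show ?thesis
  proof (rule semi_universalI, rule in_Z_if_orthogonal_commutators)
    fix X assume X: "X \<in> bond_alg G"
    show "X - ?D X \<in> bond_alg G"
      using X dla_subset[OF D_dla] by (intro closed)
    fix a b assume "a \<in> bond_alg G" "b \<in> bond_alg G"
    then have "hs (comm a b) (X - ?D X) = 0"
      by (intro orth_proj_props(2)[OF csubspace_dla] commutator_dla)
    then show "hs (X - ?D X) (comm a b) = 0"
      using hs_cnj by (metis complex_cnj_zero)
  qed
qed

text \<open>By the Jacobi identity, commuting with brackets passes from two elements to their
  commutator, hence from \<open>G\<close> to the dynamical Lie algebra. Semi-universality adds only
  central elements, whose brackets with the bond algebra vanish.\<close>

lemma semi_universal_imp_commutes: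
  assumes su: "semi_universal G" and f: "clinear_sop f"
    and c: "\<And>h X. h \<in> G \<Longrightarrow> X \<in> bond_alg G \<Longrightarrow> f (comm h X) = comm h (f X)"
    and fA: "\<And>X. X \<in> bond_alg G \<Longrightarrow> f X \<in> bond_alg G"
    and a: "a \<in> bond_alg G" and X: "X \<in> bond_alg G"
  shows "f (comm a X) = comm a (f X)"
proof -
  note f = clinear_sopD[OF f]
  obtain x z where xz: "x \<in> dla G" "z \<in> Z" "a = x + z"
    using semi_universalD[OF su a] by blast
  have "\<forall>X\<in>bond_alg G. f (comm x X) = comm x (f X)"
    using xz(1)
  proof (rule dla_induct)
    show "csubspace {x. \<forall>X\<in>bond_alg G. f (comm x X) = comm x (f X)}"
      by (auto simp: csubspace_def comm_simps f)
    show "\<forall>X\<in>bond_alg G. f (comm x X) = comm x (f X)" if "x \<in> nested_comms G" for x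
      using that
      by (induction rule: nested_comms.induct)
        (simp_all add: c comm_jacobi f comm_closed nested_comms_subset)
  qed
  then show ?thesis
    using X xz fA by (simp add: comm_simps f comm_Z)
qed

lemma sandwich_set_eq_if_semi_universal:
  assumes su: "semi_universal G"
  shows "sandwich_set P (super_commutant G) = sandwich_set P (min_super_commutant G)"
proof
  show "sandwich_set P (min_super_commutant G) \<subseteq> sandwich_set P (super_commutant G)"
    unfolding sandwich_set_image by (rule image_mono[OF min_super_commutant_subset])
  have "\<exists>E\<in>min_super_commutant G. P \<circ> F \<circ> P = P \<circ> E \<circ> P" if F: "F \<in> super_commutant G" for F
  proof -
    define f where "f = P \<circ> F"
    have F_lin: "clinear_sop F" and F_comm: "\<And>h X. h \<in> G \<Longrightarrow> F (comm h X) = comm h (F X)"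
      using F by (auto simp: super_commutant_def Lsop_def fun_eq_iff)
    have f_lin: "clinear_sop f"
      using F_lin clinear_orth_proj[OF csub] by (simp add: clinear_sop_def f_def)
    have fA: "f X \<in> bond_alg G" for X by (simp add: f_def P_closed)
    have "f (comm h X) = comm h (f X)" if "h \<in> G" "X \<in> bond_alg G" for h X
      using that by (simp add: f_def F_comm P_comm bond_alg.gen)
    then have f_comm: "f (comm a X) = comm a (f X)" if "a \<in> bond_alg G" "X \<in> bond_alg G" for a X
      by (rule semi_universal_imp_commutes[OF su f_lin _ fA that])
    \<comment> \<open>Antisymmetry lets \<open>f\<close> be pulled out of either argument: both
      sides equal \<open>f (comm x y)\<close>.\<close>
    have "comm (f x) y = comm x (f y)" if xy: "x \<in> bond_alg G" "y \<in> bond_alg G" for x y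
    proof -
      have "comm (f x) y = - f (comm y x)"
        using f_comm[OF xy(2,1)] comm_swap[of "f x" y] by simp
      also have "\<dots> = f (comm x y)"
        using clinear_sopD(4)[OF f_lin, of 0 "comm y x"] clinear_sopD(3)[OF f_lin] comm_swap[of x y]
        by simp
      finally show ?thesis using f_comm xy by simp
    qed
    then obtain z where z: "z \<in> Z" "\<And>x. x \<in> bond_alg G \<Longrightarrow> f x - z ** x \<in> Z"
      using centroid[of f, OF fA] by metis
    define m where "m X = f X - z ** X" for X
    have mZ: "m X \<in> Z" if "X \<in> bond_alg G" for X
      unfolding m_def by (rule z(2)[OF that])
    have m_lin: "clinear_sop m"
      by (simp add: clinear_sop_def m_def clinear_sopD[OF f_lin] matrix_simps smat_simps algebra_simps)
    have m_sum: "m (sum g B) = (\<Sum>b\<in>B. m (g b))" for g :: "'n op \<Rightarrow> 'n op" and B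
      by (induction B rule: infinite_finite_induct) (simp_all add: clinear_sopD[OF m_lin])
    have m_comm: "m (comm x y) = 0" if xy: "x \<in> bond_alg G" "y \<in> bond_alg G" for x y
    proof -
      have "m (comm x y) = comm x (m y)"
        using xy z by (simp add: m_def f_comm comm_simps comm_mult comm_Z)
      then show ?thesis using comm_Z mZ xy by simp
    qed
    obtain B where B: "finite B" "B \<subseteq> Z"
      "\<And>X. orth_proj Z X = smat (1/2) (\<Sum>b\<in>B. smat (hs b X) b)"
      using orth_proj_expansion[OF csubspace_Z] by blast
    \<comment> \<open>\<open>E\<close> is multiplication by \<open>z\<close> plus \<open>m\<close>
      composed with the projection onto \<open>Z\<close>. Expanding that projection writes the
      second summand as a combination of rank-one maps between central elements.\<close>
    define E where "E X = z ** X ** mat 1 + smat (1/2) (\<Sum>b\<in>B. smat (hs b X) (m b))" for X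
    have BZ: "b \<in> Z" "m b \<in> Z" if "b \<in> B" for b
      using that B(2) mZ by (auto simp: Z_def)
    have E: "E \<in> min_super_commutant G"
      unfolding E_def using BZ z Z_subset_commutant
      by (intro min_super_commutant.add min_super_commutant.sandwich min_super_commutant.scale
          min_super_commutant_sum rank_one_min_super_commutant one_commutant) auto
    have "f Y = P (E Y)" if Y: "Y \<in> bond_alg G" for Y
    proof -
      have PZ: "orth_proj Z Y \<in> Z" by (rule orth_proj_props(1)[OF csubspace_Z])
      \<comment> \<open>\<open>m\<close> kills commutators, hence everything in the bond algebra
        orthogonal to \<open>Z\<close>, so it factors through the projection onto
        \<open>Z\<close>.\<close>
      have "m (Y - orth_proj Z Y) = 0"
      proof (rule vanish_if_vanish_on_commutators[OF m_lin m_comm])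
        show "Y - orth_proj Z Y \<in> bond_alg G"
          using PZ Y closed(4) by (auto simp: Z_def)
      qed (use orth_proj_props(2)[OF csubspace_Z] in auto)
      then have "m Y = m (orth_proj Z Y)" by (simp add: clinear_sopD[OF m_lin])
      also have "\<dots> = smat (1/2) (\<Sum>b\<in>B. smat (hs b Y) (m b))"
        by (simp add: B(3) clinear_sopD[OF m_lin] m_sum)
      finally have "E Y = f Y" by (simp add: E_def m_def diff_eq_eq add.commute)
      then show ?thesis using fA csub by simp
    qed
    then have "P \<circ> F \<circ> P = P \<circ> E \<circ> P"
      using P_closed by (simp add: fun_eq_iff f_def)
    then show ?thesis using E by blast
  qed
  then show "sandwich_set P (super_commutant G) \<subseteq> sandwich_set P (min_super_commutant G)"
    unfolding sandwich_set_image image_subset_iff image_iff by blast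
qed

end

theorem theorem1:
  fixes G :: "('n::finite) op set"
  assumes "finite G"
    and "\<forall>h\<in>G. hermitian h"
  shows "semi_universal G \<longleftrightarrow>
    sandwich_set (orth_proj (bond_alg G)) (super_commutant G)
      = sandwich_set (orth_proj (bond_alg G)) (min_super_commutant G)"
proof -
  interpret hermitian_generators G using assms(2) by unfold_locales blast
  show ?thesis
    using semi_universal_if_sandwich_set_eq sandwich_set_eq_if_semi_universal by blast
qed

end
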